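(* Let $p$ be an odd prime and $m$ a positive integer, and let $\alpha$ be a fixed non-square element of $\mathbb{F}_{p^m}$. For an integer $k$ with $m/\gcd(m,k)$ odd and a field automorphism $\sigma$ of $\mathbb{F}_{p^m}$, let $\mathbb{P}_{k,\sigma}=(\mathbb{F}_{p^m}^2,+,*_{k,\sigma})$ be the presemifield with $$(a,b)*_{k,\sigma}(c,d)=\big(a\circ_k c+\alpha\,\sigma(b\circ_k d),\ ad+bc\big),\qquad x\circ_k y=x^{p^k}y+y^{p^k}x.$$ Let $0<k,s\le\lfloor m/2\rfloor$ with $m/\gcd(m,k)$ and $m/\gcd(m,s)$ odd, and $0\le r,t\le\lfloor m/2\rfloor$, and let $\sigma(x)=x^{p^r}$, $\tau(x)=x^{p^t}$. If $(k,\sigma)\neq(s,\tau)$, then $\mathbb{P}_{k,\sigma}$ and $\mathbb{P}_{s,\tau}$ are not strongly isotopic.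
   Context: Two presemifields $(\mathbb{F}_p^n,+,* )$ and $(\mathbb{F}_p^n,+,\star)$ are isotopic if there are $\mathbb{F}_p$-linear bijections $M,N,L$ with $M(x)\star N(y)=L(x*y)$ for all $x,y$; they are strongly isotopic if such an isotopism exists with $M=N$. For commutative presemifields of odd characteristic, strong isotopism is equivalent to linear equivalence of the planar functions $x\mapsto x*x$. *)

theory Defs
  imports "HOL-Computational_Algebra.Primes"
begin

text \<open>The field F_{p^m} is modelled by a finite field type 'a with CARD('a) = p^m.
  Elements of F_{p^m}^2 are pairs.\<close>

definition circ :: "nat \<Rightarrow> nat \<Rightarrow> 'a::field \<Rightarrow> 'a \<Rightarrow> 'a" where
  "circ p k x y = x ^ (p ^ k) * y + y ^ (p ^ k) * x"

definition pmult :: "nat \<Rightarrow> 'a::field \<Rightarrow> nat \<Rightarrow> ('a \<Rightarrow> 'a) \<Rightarrow> 'a \<times> 'a \<Rightarrow> 'a \<times> 'a \<Rightarrow> 'a \<times> 'a" where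
  "pmult p \<alpha> k \<sigma> u v =
     (case u of (a, b) \<Rightarrow> case v of (c, d) \<Rightarrow>
       (circ p k a c + \<alpha> * \<sigma> (circ p k b d), a * d + b * c))"

definition fp_linear2 :: "('a::field \<times> 'a \<Rightarrow> 'a \<times> 'a) \<Rightarrow> bool" where
  "fp_linear2 f \<longleftrightarrow>
     (\<forall>a b c d. f (a + c, b + d) = (fst (f (a, b)) + fst (f (c, d)), snd (f (a, b)) + snd (f (c, d)))) \<and>
     (\<forall>(n::nat) a b. f (of_nat n * a, of_nat n * b) = (of_nat n * fst (f (a, b)), of_nat n * snd (f (a, b))))"

definition strongly_isotopic ::
  "('a::field \<times> 'a \<Rightarrow> 'a \<times> 'a \<Rightarrow> 'a \<times> 'a) \<Rightarrow> ('a \<times> 'a \<Rightarrow> 'a \<times> 'a \<Rightarrow> 'a \<times> 'a) \<Rightarrow> bool" where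
  "strongly_isotopic mul1 mul2 \<longleftrightarrow>
     (\<exists>M L. fp_linear2 M \<and> bij M \<and> fp_linear2 L \<and> bij L \<and>
        (\<forall>x y. mul2 (M x) (M y) = L (mul1 x y)))"

end

theory Submission
  imports Defs "HOL-Number_Theory.Residues" "HOL-Computational_Algebra.Polynomial"
begin

text \<open>
  Write a strong isotopism as \<open>M (x, y) = (A x + B y, C x + D y)\<close> with \<open>A, B, C, D\<close> linearized
  polynomials, whose coefficients are indexed modulo \<open>m\<close>. The second component of the isotopism
  identity says that \<open>A x * D y + C x * B y\<close> is a function of \<open>x * y\<close>, so its coefficient matrix
  is diagonal, and that \<open>A x * C y + C x * A y\<close> and \<open>B x * D y + D x * B y\<close> only have coefficients
  \<open>(i, j)\<close> with \<open>j - i\<close> equal to \<open>k\<close> or \<open>- k\<close>. This leaves two cases: \<open>A\<close> and \<open>D\<close> are monomials of the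
  same degree, or \<open>B\<close> and \<open>C\<close> are. In the first case the mixed part of the first component forces
  \<open>B = C = 0\<close>; here it is used that \<open>k\<close> and \<open>s\<close> generate an odd subgroup modulo \<open>m\<close>. Comparing
  the degrees in the remaining parts gives \<open>s = k\<close> and \<open>t = r\<close>. The second case
  is the first one for the product with \<open>t\<close> replaced by \<open>- t\<close>, hence \<open>t + r = 0\<close> modulo \<open>m\<close>, and
  the bounds on \<open>r\<close> and \<open>t\<close> again give \<open>t = r\<close>.
\<close>

section \<open>Powers in finite fields\<close>

lemma card_power_eq_self_le:
  fixes n :: nat
  assumes "1 < n"
  shows "card {x :: 'a::idom. x ^ n = x} \<le> n"
proof -
  let ?q = "monom 1 n - monom 1 1 :: 'a poly"
  have "coeff ?q n = 1" using assms by simp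
  then have "?q \<noteq> 0" by (metis coeff_0 zero_neq_one)
  then have "card {x. poly ?q x = 0} \<le> degree ?q" by (rule card_poly_roots_bound)
  also have "degree ?q \<le> n"
    using assms by (intro degree_diff_le) (auto simp: degree_monom_eq)
  finally show ?thesis by (simp add: poly_monom)
qed

text \<open>Multiplication by a nonzero \<open>x\<close> permutes the nonzero elements; comparing
  their products gives the exponent.\<close>

lemma power_card_eq_self:
  fixes x :: "'a::{field,finite}"
  shows "x ^ card (UNIV :: 'a set) = x"
proof (cases "x = 0")
  case True
  then show ?thesis by (simp add: finite_UNIV_card_ge_0)
next
  case False
  have eq: "(*) x ` (UNIV - {0}) = UNIV - {0}"
    by (rule endo_inj_surj) (use False in \<open>auto simp: inj_on_def\<close>)
  have "prod id (UNIV - {0 :: 'a}) = (\<Prod>y\<in>UNIV - {0}. x * y)"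
    by (subst eq[symmetric], subst prod.reindex) (use False in \<open>auto simp: inj_on_def\<close>)
  also have "\<dots> = x ^ (card (UNIV :: 'a set) - 1) * prod id (UNIV - {0})"
    by (simp add: prod.distrib card_Diff_singleton)
  finally have "x ^ (card (UNIV :: 'a set) - 1) = 1" by simp
  then show ?thesis
    by (metis finite_UNIV_card_ge_0[OF finite] mult.right_neutral power_minus_mult mult.left_neutral)
qed

section \<open>Frobenius powers with indices modulo \<open>m\<close>\<close>

locale frobenius =
  fixes p m :: nat and F :: "'a::{field,finite} itself"
  assumes prime_p: "prime p" and card_F: "card (UNIV :: 'a set) = p ^ m"
begin

text \<open>With integer indices \<open>fr (- n)\<close> inverts \<open>fr n\<close>, and
  coefficient indices can be shifted freely.\<close>

definition fr :: "int \<Rightarrow> 'a \<Rightarrow> 'a" where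
  "fr n x = x ^ (p ^ nat (n mod int m))"

lemma m_pos: "0 < m"
proof (rule ccontr)
  assume "\<not> 0 < m"
  then have "card (UNIV :: 'a set) = 1" using card_F by simp
  then have "(0 :: 'a) = 1" by (metis UNIV_I card_1_singletonE singletonD)
  then show False by simp
qed

lemma char_F: "CHAR('a) = p"
proof -
  have "prime CHAR('a)"
    using prime_CHAR_semidom[where ?'a = 'a] finite_imp_CHAR_pos[where ?'a = 'a] by simp
  moreover have "CHAR('a) dvd p ^ m" using CHAR_dvd_CARD[where ?'a = 'a] card_F by simp
  ultimately show ?thesis using prime_p by (meson prime_dvd_power primes_dvd_imp_eq)
qed

lemma power_q: "x ^ (p ^ m) = (x :: 'a)"
  using power_card_eq_self[of x] card_F by simp

lemma fr_cong: "[i = j] (mod int m) \<Longrightarrow> fr i = fr j"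
  by (simp add: fr_def cong_def fun_eq_iff)

lemma power_reduce: "(x :: 'a) ^ (p ^ n) = x ^ (p ^ (n mod m))"
proof (induction n rule: less_induct)
  case (less n)
  show ?case
  proof (cases "n < m")
    case False
    then have "x ^ (p ^ n) = (x ^ (p ^ m)) ^ (p ^ (n - m))"
      by (simp flip: power_mult power_add)
    also have "\<dots> = x ^ (p ^ (n - m))" by (simp add: power_q)
    also have "\<dots> = x ^ (p ^ ((n - m) mod m))"
      using False m_pos by (intro less) auto
    finally show ?thesis using False by (simp add: le_mod_geq)
  qed simp
qed

lemma fr_int: "fr (int n) x = x ^ (p ^ n)"
  by (subst power_reduce) (simp add: fr_def flip: zmod_int)

lemma fr_fr [simp]: "fr i (fr j x) = fr (i + j) x"
proof -
  let ?n = "nat (j mod int m) + nat (i mod int m)"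
  have *: "int ?n = j mod int m + i mod int m" using m_pos by simp
  have "fr i (fr j x) = fr (int ?n) x"
    by (simp only: fr_int) (simp add: fr_def power_add power_mult)
  also have "\<dots> = fr (i + j) x"
    unfolding * by (rule arg_cong[OF fr_cong, THEN fun_cong, of _ _ "\<lambda>x. x"])
      (simp add: cong_def mod_simps add.commute)
  finally show ?thesis .
qed

lemma fr_id [simp]: "fr 0 x = x"
  using fr_int[of 0 x] by simp

lemma fr_zero [simp]: "fr i 0 = 0"
  using prime_gt_0_nat[OF prime_p] by (simp add: fr_def)

lemma fr_mult: "fr i (x * y) = fr i x * fr i y"
  by (simp add: fr_def power_mult_distrib)

lemma fr_divide: "fr i (x / y) = fr i x / fr i y"
  by (simp add: fr_def power_divide)

lemma fr_add: "fr i (x + y) = fr i x + fr i y"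
  unfolding fr_def using prime_p char_F by (intro freshmans_dream') auto

lemma fr_sum: "fr i (sum f S) = (\<Sum>x\<in>S. fr i (f x))"
  unfolding fr_def using prime_p char_F by (intro freshmans_dream_sum') auto

lemma fr_eq_0_iff [simp]: "fr i x = 0 \<longleftrightarrow> x = 0"
  using prime_gt_0_nat[OF prime_p] by (simp add: fr_def)

lemma fr_uminus: "fr i (- x) = - fr i x"
  by (metis add.right_inverse add_eq_0_iff fr_add fr_zero)

lemma bij_fr: "bij (fr i)"
  by (rule o_bij[of "fr (- i)"]) (auto simp: fun_eq_iff)

lemma sum_fr: "(\<Sum>x\<in>UNIV. f (fr i x)) = (\<Sum>x\<in>UNIV. f x)"
  by (rule sum.reindex_bij_betw) (use bij_fr in auto)

lemma sum_scale: "c \<noteq> 0 \<Longrightarrow> (\<Sum>x\<in>UNIV. f (c * x)) = (\<Sum>x\<in>(UNIV :: 'a set). f x)"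
  by (rule sum.reindex_bij_betw, rule o_bij[of "\<lambda>x. x / c"]) (auto simp: fun_eq_iff)

lemma of_nat_card: "(of_nat (p ^ m) :: 'a) = 0"
  using char_F m_pos by (simp add: of_nat_eq_0_iff_char_dvd)

text \<open>Otherwise all \<open>p ^ m\<close> elements would be roots of
  \<open>X ^ (p ^ n) - X\<close> for some \<open>0 < n < m\<close>, more than its degree
  allows.\<close>

lemma ex_fr_neq:
  assumes "\<not> [i = j] (mod int m)"
  obtains g where "fr i g \<noteq> fr j g"
proof (rule ccontr)
  assume "\<not> thesis"
  then have *: "fr i g = fr j g" for g using that by blast
  define n where "n = nat ((i - j) mod int m)"
  have n: "0 < n" "n < m"
    using assms m_pos unfolding n_def
    by (auto simp: cong_iff_dvd_diff dvd_eq_mod_eq_0 nat_less_iff)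
      (meson linorder_not_le mod_pos_pos_trivial of_nat_0_less_iff order_less_le pos_mod_bound pos_mod_sign)+
  have "fr (i - j) x = x" for x
    using *[of "fr (- j) x"] by simp
  then have "x ^ (p ^ n) = x" for x :: 'a
    by (simp add: fr_def n_def)
  moreover have "1 < p ^ n" using n prime_gt_1_nat[OF prime_p] by (intro one_less_power)
  ultimately have "card (UNIV :: 'a set) \<le> p ^ n"
    using card_power_eq_self_le[of "p ^ n", where ?'a = 'a] by simp
  moreover have "p ^ n < p ^ m"
    using n prime_gt_1_nat[OF prime_p] by (simp add: power_strict_increasing)
  ultimately show False using card_F by simp
qed

section \<open>Orthogonality and coefficients of linearized polynomials\<close>

lemma fr_orthogonal:
  "(\<Sum>x\<in>UNIV. fr i x / fr j x) = - of_bool [i = j] (mod int m)"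
proof (cases "[i = j] (mod int m)")
  case True
  \<comment> \<open>The term at 0 is \<open>0 / 0 = 0\<close>.\<close>
  have "(\<Sum>x\<in>UNIV. fr i x / fr j x) = (\<Sum>x\<in>UNIV - {0}. fr i x / fr j x)"
    by (rule sum.mono_neutral_right) auto
  also have "\<dots> = (\<Sum>x\<in>UNIV - {0::'a}. 1)"
    using fr_cong[OF True] by (intro sum.cong) auto
  also have "\<dots> = of_nat (p ^ m - 1)"
    using card_F by (simp add: card_Diff_singleton)
  also have "\<dots> = - 1"
    using of_nat_card prime_gt_0_nat[OF prime_p] by (simp add: of_nat_diff)
  finally show ?thesis using True by simp
next
  case False
  then obtain g where g: "fr i g \<noteq> fr j g" by (rule ex_fr_neq)
  then have "g \<noteq> 0" by auto
  \<comment> \<open>Replacing \<open>x\<close> by \<open>g * x\<close> multiplies the sum by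
    \<open>fr i g / fr j g\<close>, which is not 1, so the sum vanishes.\<close>
  have "(\<Sum>x\<in>UNIV. fr i x / fr j x) = (\<Sum>x\<in>UNIV. fr i (g * x) / fr j (g * x))"
    by (rule sum_scale[OF \<open>g \<noteq> 0\<close>, symmetric])
  also have "\<dots> = fr i g / fr j g * (\<Sum>x\<in>UNIV. fr i x / fr j x)"
    by (simp add: fr_mult sum_distrib_left)
  finally have "(1 - fr i g / fr j g) * (\<Sum>x\<in>UNIV. fr i x / fr j x) = 0"
    by (simp add: algebra_simps)
  with g \<open>g \<noteq> 0\<close> show ?thesis using False by auto
qed

text \<open>By orthogonality of the maps \<open>fr i\<close>, \<open>cf f i\<close> is the coefficient of \<open>x ^ (p ^ i)\<close> in a
  linearized polynomial \<open>f\<close>, and \<open>cf2 G i j\<close> that of \<open>x ^ (p ^ i) * y ^ (p ^ j)\<close> in \<open>G\<close>. The terms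
  with denominator 0 vanish since \<open>x / 0 = 0\<close>.\<close>

definition cf :: "('a \<Rightarrow> 'a) \<Rightarrow> int \<Rightarrow> 'a" where
  "cf f i = - (\<Sum>x\<in>UNIV. f x / fr i x)"

definition cf2 :: "('a \<Rightarrow> 'a \<Rightarrow> 'a) \<Rightarrow> int \<Rightarrow> int \<Rightarrow> 'a" where
  "cf2 G i j = (\<Sum>x\<in>UNIV. \<Sum>y\<in>UNIV. G x y / (fr i x * fr j y))"

lemma cf_cong: "[i = j] (mod int m) \<Longrightarrow> cf f i = cf f j"
  by (simp add: cf_def fr_cong)

lemma cf2_add: "cf2 (\<lambda>x y. G x y + H x y) i j = cf2 G i j + cf2 H i j"
  by (simp add: cf2_def sum.distrib add_divide_distrib)

lemma cf2_scale: "cf2 (\<lambda>x y. c * G x y) i j = c * cf2 G i j"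
  by (simp add: cf2_def sum_distrib_left)

lemma cf2_prod: "cf2 (\<lambda>x y. f x * g y) i j = cf f i * cf g j"
  by (simp add: cf2_def cf_def sum_product)

lemma cf2_swap: "cf2 (\<lambda>x y. G y x) i j = cf2 G j i"
  unfolding cf2_def by (subst sum.swap) (simp add: mult.commute)

lemma cf_fr_comp: "cf (\<lambda>x. fr n (f x)) i = fr n (cf f (i - n))"
  by (simp add: cf_def fr_uminus fr_sum fr_divide)

lemma cf2_fr_comp: "cf2 (\<lambda>x y. fr n (G x y)) i j = fr n (cf2 G (i - n) (j - n))"
  by (simp add: cf2_def fr_sum fr_divide fr_mult)

lemma cf_comp_fr: "cf (\<lambda>x. f (fr n x)) i = cf f (i - n)"
  using sum_fr[of "\<lambda>x. f x / fr (i - n) x" n] by (simp add: cf_def)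

lemma cf_comp_scale:
  assumes "c \<noteq> 0"
  shows "cf (\<lambda>x. f (c * x)) i = fr i c * cf f i"
proof -
  have "(\<Sum>x\<in>UNIV. f (c * x) / fr i x) = (\<Sum>x\<in>UNIV. fr i c * (f (c * x) / fr i (c * x)))"
    using assms by (simp add: fr_mult)
  also have "\<dots> = fr i c * (\<Sum>x\<in>UNIV. f x / fr i x)"
    by (subst sum_scale[OF assms, of "\<lambda>x. fr i c * (f x / fr i x)"]) (simp add: sum_distrib_left)
  finally show ?thesis by (simp add: cf_def)
qed

text \<open>For nonzero \<open>y\<close> the product \<open>y * x\<close> runs over the field with
  \<open>x\<close>, so the inner sum is a multiple of \<open>cf L i\<close>; orthogonality evaluates
  the sum over \<open>y\<close>.\<close>

lemma cf2_diag: "cf2 (\<lambda>x y. L (x * y)) i j = of_bool [i = j] (mod int m) * cf L i"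
proof -
  have *: "(\<Sum>x\<in>UNIV. L (x * y) / (fr i x * fr j y)) = - cf L i * (fr i y / fr j y)" for y
  proof (cases "y = 0")
    case False
    have "(\<Sum>x\<in>UNIV. L (x * y) / (fr i x * fr j y))
        = (\<Sum>x\<in>UNIV. (L (y * x) / fr i (y * x)) * (fr i y / fr j y))"
      using False by (intro sum.cong) (auto simp: fr_mult mult.commute)
    also have "\<dots> = (\<Sum>x\<in>UNIV. (L x / fr i x) * (fr i y / fr j y))"
      using False by (rule sum_scale)
    finally show ?thesis by (simp only: cf_def sum_distrib_right minus_minus)
  qed auto
  show ?thesis
    unfolding cf2_def
    by (subst sum.swap) (simp only: * sum_distrib_left[symmetric] fr_orthogonal, simp)
qed

lemma cf2_comp_fr: "cf2 (\<lambda>x y. G (fr n x) y) i j = cf2 G (i - n) j"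
  using sum_fr[of "\<lambda>x. \<Sum>y\<in>UNIV. G x y / (fr (i - n) x * fr j y)" n] by (simp add: cf2_def)

section \<open>The prime field, the trace and vanishing of additive maps\<close>

lemma fixed_in_prime_field:
  assumes "x ^ p = (x :: 'a)"
  obtains n where "x = of_nat n"
proof -
  have inj: "inj_on (of_nat :: nat \<Rightarrow> 'a) {..<p}"
    by (auto simp: inj_on_def of_nat_eq_iff_cong_CHAR char_F cong_def)
  have "of_nat ` {..<p} \<subseteq> {x :: 'a. x ^ p = x}"
  proof -
    have "of_nat n ^ p = (of_nat n :: 'a)" for n
      using prime_p char_F by (induction n) (auto simp: freshmans_dream zero_power prime_gt_0_nat)
    then show ?thesis by auto
  qed
  \<comment> \<open>At most \<open>p\<close> roots exist, and the \<open>p\<close> distinct images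
    of the numbers below \<open>p\<close> already supply them.\<close>
  moreover have "card {x :: 'a. x ^ p = x} \<le> card (of_nat ` {..<p} :: 'a set)"
    using card_power_eq_self_le[OF prime_gt_1_nat[OF prime_p], where ?'a = 'a] inj
    by (simp add: card_image)
  ultimately have "of_nat ` {..<p} = {x :: 'a. x ^ p = x}"
    by (intro card_seteq) auto
  with assms that show ?thesis by blast
qed

lemma trace_in_prime_field:
  obtains n where "(\<Sum>i<m. fr (int i) x) = of_nat n"
proof (rule fixed_in_prime_field)
  have "(\<Sum>i<m. fr (int i) x) ^ p = fr 1 (\<Sum>i<m. fr (int i) x)"
    using fr_int[of 1] by simp
  also have "\<dots> = (\<Sum>i<m. fr (int (Suc i)) x)"
    by (simp add: fr_sum)
  \<comment> \<open>The shifted indices run from 1 to \<open>m\<close>, and index \<open>m\<close>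
    acts as index 0.\<close>
  also have "\<dots> = (\<Sum>i<m. fr (int i) x)"
  proof -
    have "fr (int m) x = fr 0 x" by (rule fun_cong[OF fr_cong]) (simp add: cong_def)
    then show ?thesis
      using sum.lessThan_Suc_shift[of "\<lambda>i. fr (int i) x" m] by simp
  qed
  finally show "(\<Sum>i<m. fr (int i) x) ^ p = (\<Sum>i<m. fr (int i) x)" .
qed (use that in blast)

text \<open>With \<open>tr\<close> the trace to the prime field, \<open>\<Sum>x. f (tr x * z / x)\<close> equals \<open>f (- z)\<close> by additivity
  and orthogonality, and is a combination of the \<open>cf f i\<close> by linearity over the prime field.\<close>

lemma additive_eq_0:
  assumes add: "\<And>x y. f (x + y) = f x + f y"
    and scale: "\<And>n x. f (of_nat n * x) = of_nat n * f x"
    and cf: "\<And>i. cf f i = 0"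
  shows "f z = 0"
proof -
  define tr where "tr x = (\<Sum>i<m. fr (int i) x)" for x
  have f0: "f 0 = 0" using scale[of 0 0] by simp
  have f_sum: "f (sum g S) = (\<Sum>x\<in>S. f (g x))" for g :: "'a \<Rightarrow> 'a" and S
    by (induction S rule: infinite_finite_induct) (auto simp: f0 add)
  have "f (z * (\<Sum>x\<in>UNIV. tr x / x)) = (\<Sum>x\<in>UNIV. f (tr x * (z / x)))"
    by (simp add: sum_distrib_left f_sum mult.commute)
  also have "\<dots> = (\<Sum>x\<in>UNIV. tr x * f (z / x))"
    by (intro sum.cong refl) (metis scale trace_in_prime_field tr_def)
  also have "\<dots> = (\<Sum>x\<in>UNIV. tr (z / x) * f x)"
  proof (cases "z = 0")
    case False
    have "(\<Sum>x\<in>UNIV. tr x * f (z / x)) = (\<Sum>x\<in>UNIV - {0}. tr x * f (z / x))"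
      by (rule sum.mono_neutral_right) (auto simp: f0)
    also have "\<dots> = (\<Sum>x\<in>UNIV - {0}. tr (z / x) * f x)"
      by (rule sum.reindex_bij_witness[of _ "\<lambda>x. z / x" "\<lambda>x. z / x"]) (use False in auto)
    also have "\<dots> = (\<Sum>x\<in>UNIV. tr (z / x) * f x)"
      by (rule sum.mono_neutral_left) (auto simp: f0)
    finally show ?thesis .
  qed (auto simp: f0 tr_def)
  also have "\<dots> = (\<Sum>i<m. fr (int i) z * (\<Sum>x\<in>UNIV. f x / fr (int i) x))"
    unfolding tr_def by (simp add: sum_distrib_left sum_distrib_right fr_divide)
      (subst sum.swap, simp)
  also have "\<dots> = 0"
    using cf by (simp add: cf_def)
  finally have *: "f (z * (\<Sum>x\<in>UNIV. tr x / x)) = 0" .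
  have "(\<Sum>x\<in>UNIV. tr x / x) = (\<Sum>i<m. \<Sum>x\<in>UNIV. fr (int i) x / fr 0 x)"
    unfolding tr_def by (simp add: sum_divide_distrib) (rule sum.swap)
  also have "\<dots> = (\<Sum>i<m. - of_bool (i = 0))"
    by (intro sum.cong refl, simp only: fr_orthogonal) (auto simp: cong_0_iff dest: dvd_imp_le)
  also have "\<dots> = - 1"
    using m_pos by (simp add: sum_negf of_bool_def sum.delta)
  finally have "f (- z) = 0" using * by simp
  then show ?thesis using add[of z "- z"] f0 by simp
qed

section \<open>Coefficients of expressions in \<open>circ_fr\<close>\<close>

definition circ_fr :: "int \<Rightarrow> 'a \<Rightarrow> 'a \<Rightarrow> 'a" where
  "circ_fr k x y = fr k x * y + fr k y * x"

lemma cf2_circ_fr: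
  "cf2 (\<lambda>x y. circ_fr n (f x) (g y)) i j = fr n (cf f (i - n)) * cf g j + fr n (cf g (j - n)) * cf f i"
proof -
  have "cf2 (\<lambda>x y. circ_fr n (f x) (g y)) i j
      = cf2 (\<lambda>x y. fr n (f x) * g y) i j + cf2 (\<lambda>x y. f x * fr n (g y)) i j"
    by (simp add: circ_fr_def cf2_add mult.commute)
  then show ?thesis by (simp only: cf2_prod cf_fr_comp) (simp add: mult.commute)
qed

text \<open>Each summand is a plain product with \<open>fr n\<close> applied to one variable, so
  \<open>cf2_diag\<close> applies after shifting that index by \<open>n\<close>.\<close>

lemma cf2_comp_circ_fr:
  assumes "\<And>x y. L (x + y) = L x + L y"
  shows "cf2 (\<lambda>x y. L (circ_fr n x y)) i j =
    of_bool [i - n = j] (mod int m) * cf L j + of_bool [j - n = i] (mod int m) * cf L i"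
proof -
  have "cf2 (\<lambda>x y. L (fr n x * y)) i j = of_bool [i - n = j] (mod int m) * cf L j" for i j
    using cf2_comp_fr[of "\<lambda>x y. L (x * y)" n i j] cf_cong[of "i - n" j L] by (auto simp: cf2_diag)
  from this[of i j] this[of j i] show ?thesis
    using cf2_swap[of "\<lambda>x y. L (fr n x * y)" i j] by (simp add: circ_fr_def assms cf2_add)
qed

text \<open>The order of \<open>z\<close> modulo \<open>m\<close> divides both 2 and the odd number
  \<open>N\<close>. This later rules out coincidences of indices.\<close>

lemma odd_torsion:
  fixes z N :: int
  assumes "odd N" "int m dvd N * z" "int m dvd 2 * z"
  shows "int m dvd z"
proof -
  obtain h where "N = 2 * h + 1" using \<open>odd N\<close> by (rule oddE)
  then have "z = N * z - h * (2 * z)" by (simp add: algebra_simps)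
  then show ?thesis using assms by (metis dvd_diff dvd_mult)
qed

end

section \<open>The component equations of a strong isotopism\<close>

text \<open>The integer \<open>N\<close> witnesses that \<open>k\<close> and \<open>s\<close> have odd order modulo \<open>m\<close>. The scalars \<open>\<alpha>\<close> and \<open>\<beta>\<close> of
  the two products are kept apart because \<open>swapped\<close> below changes only the first.\<close>

locale isotopism = frobenius p m F for p m and F :: "'a::{field,finite} itself" +
  fixes N k s r t :: int and \<alpha> \<beta> :: 'a
    and A B C D L1 L2 L3 L4 :: "'a \<Rightarrow> 'a"
  assumes odd_p: "odd p"
    and odd_N: "odd N" and N_k: "int m dvd N * k" and N_s: "int m dvd N * s"
    and k_nz: "\<not> int m dvd k" and s_nz: "\<not> int m dvd s" and ks_nz: "\<not> int m dvd s + k"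
    and \<alpha>_nz: "\<alpha> \<noteq> 0" and \<beta>_nz: "\<beta> \<noteq> 0"
    and L1_add: "L1 (x + y) = L1 x + L1 y"
    and L3_add: "L3 (x + y) = L3 x + L3 y"
    and eq_AC: "circ_fr s (A x) (A y) + \<alpha> * fr t (circ_fr s (C x) (C y)) = L1 (circ_fr k x y)"
    and eq_AC': "A x * C y + C x * A y = L3 (circ_fr k x y)"
    and eq_BD: "circ_fr s (B x) (B y) + \<alpha> * fr t (circ_fr s (D x) (D y)) = L1 (\<beta> * fr r (circ_fr k x y))"
    and eq_BD': "B x * D y + D x * B y = L3 (\<beta> * fr r (circ_fr k x y))"
    and eq_ABCD: "circ_fr s (A x) (B y) + \<alpha> * fr t (circ_fr s (C x) (D y)) = L2 (x * y)"
    and eq_ABCD': "A x * D y + C x * B y = L4 (x * y)"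
begin

text \<open>Exchanging \<open>(A, B)\<close> with \<open>(C, D)\<close> and composing the first component with the inverse of
  \<open>x \<mapsto> \<alpha> * fr t x\<close> preserves the equations.\<close>

lemma swapped:
  "isotopism p m N k s r (- t) (fr (- t) (1 / \<alpha>)) \<beta> C D A B
     (\<lambda>z. fr (- t) (1 / \<alpha> * L1 z)) (\<lambda>z. fr (- t) (1 / \<alpha> * L2 z)) L3 L4"
proof unfold_locales
  have *: "v + fr (- t) (1 / \<alpha>) * fr (- t) u = fr (- t) (1 / \<alpha> * w)"
    if "u + \<alpha> * fr t v = w" for u v w
  proof -
    have "1 / \<alpha> * w = 1 / \<alpha> * u + fr t v"
      using \<alpha>_nz by (simp flip: that add: field_simps)
    then show ?thesis by (simp only: fr_add fr_mult) (simp add: fr_mult)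
  qed
  show "circ_fr s (C x) (C y) + fr (- t) (1 / \<alpha>) * fr (- t) (circ_fr s (A x) (A y))
      = fr (- t) (1 / \<alpha> * L1 (circ_fr k x y))" for x y
    by (rule *) (rule eq_AC)
  show "circ_fr s (D x) (D y) + fr (- t) (1 / \<alpha>) * fr (- t) (circ_fr s (B x) (B y))
      = fr (- t) (1 / \<alpha> * L1 (\<beta> * fr r (circ_fr k x y)))" for x y
    by (rule *) (rule eq_BD)
  show "circ_fr s (C x) (D y) + fr (- t) (1 / \<alpha>) * fr (- t) (circ_fr s (A x) (B y))
      = fr (- t) (1 / \<alpha> * L2 (x * y))" for x y
    by (rule *) (rule eq_ABCD)
  show "C x * A y + A x * C y = L3 (circ_fr k x y)" for x y
    using eq_AC'[of x y] by (simp add: add.commute)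
  show "D x * B y + B x * D y = L3 (\<beta> * fr r (circ_fr k x y))" for x y
    using eq_BD'[of x y] by (simp add: add.commute)
  show "C x * B y + A x * D y = L4 (x * y)" for x y
    using eq_ABCD'[of x y] by (simp add: add.commute)
qed (use odd_p odd_N N_k N_s k_nz s_nz ks_nz \<alpha>_nz \<beta>_nz in
    \<open>auto simp: L1_add L3_add fr_add distrib_left add_divide_distrib\<close>)

section \<open>Comparison of coefficients\<close>

lemma cf_AC:
  "fr s (cf A (i - s)) * cf A j + fr s (cf A (j - s)) * cf A i
     + \<alpha> * fr t (fr s (cf C (i - t - s)) * cf C (j - t) + fr s (cf C (j - t - s)) * cf C (i - t))
   = of_bool [i - k = j] (mod int m) * cf L1 j + of_bool [j - k = i] (mod int m) * cf L1 i"
proof -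
  have "cf2 (\<lambda>x y. circ_fr s (A x) (A y) + \<alpha> * fr t (circ_fr s (C x) (C y))) i j
      = cf2 (\<lambda>x y. L1 (circ_fr k x y)) i j" by (simp only: eq_AC)
  then show ?thesis
    by (simp only: cf2_add cf2_scale cf2_fr_comp cf2_circ_fr cf2_comp_circ_fr[OF L1_add])
qed

lemma cf_BD:
  "fr s (cf B (i - s)) * cf B j + fr s (cf B (j - s)) * cf B i
     + \<alpha> * fr t (fr s (cf D (i - t - s)) * cf D (j - t) + fr s (cf D (j - t - s)) * cf D (i - t))
   = of_bool [i - k = j] (mod int m) * (fr (j - r) \<beta> * cf L1 (j - r))
     + of_bool [j - k = i] (mod int m) * (fr (i - r) \<beta> * cf L1 (i - r))"
proof -
  let ?L = "\<lambda>z. L1 (\<beta> * fr r z)"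
  have L: "cf ?L i = fr (i - r) \<beta> * cf L1 (i - r)" for i
    using cf_comp_fr[of "\<lambda>z. L1 (\<beta> * z)" r i] \<beta>_nz by (simp add: cf_comp_scale)
  have "cf2 (\<lambda>x y. circ_fr s (B x) (B y) + \<alpha> * fr t (circ_fr s (D x) (D y))) i j
      = cf2 (\<lambda>x y. ?L (circ_fr k x y)) i j" by (simp only: eq_BD)
  also have "\<dots> = of_bool [i - k = j] (mod int m) * cf ?L j + of_bool [j - k = i] (mod int m) * cf ?L i"
    by (rule cf2_comp_circ_fr) (simp add: fr_add L1_add distrib_left)
  finally show ?thesis
    by (simp only: cf2_add cf2_scale cf2_fr_comp cf2_circ_fr L)
qed

lemma cf_AC':
  assumes "\<not> [i - k = j] (mod int m)" "\<not> [j - k = i] (mod int m)"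
  shows "cf A i * cf C j + cf C i * cf A j = 0"
proof -
  have "cf2 (\<lambda>x y. A x * C y + C x * A y) i j = cf2 (\<lambda>x y. L3 (circ_fr k x y)) i j"
    by (simp only: eq_AC')
  then show ?thesis
    using assms by (simp add: cf2_add cf2_prod cf2_comp_circ_fr[OF L3_add])
qed

lemma cf_BD':
  assumes "\<not> [i - k = j] (mod int m)" "\<not> [j - k = i] (mod int m)"
  shows "cf B i * cf D j + cf D i * cf B j = 0"
proof -
  have "cf2 (\<lambda>x y. B x * D y + D x * B y) i j = cf2 (\<lambda>x y. L3 (\<beta> * fr r (circ_fr k x y))) i j"
    by (simp only: eq_BD')
  also have "\<dots> = 0"
    using assms by (subst cf2_comp_circ_fr) (simp_all add: fr_add L3_add distrib_left)
  finally show ?thesis by (simp add: cf2_add cf2_prod)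
qed

lemma cf_ABCD:
  assumes "\<not> [i = j] (mod int m)"
  shows "fr s (cf A (i - s)) * cf B j + fr s (cf B (j - s)) * cf A i
     + \<alpha> * fr t (fr s (cf C (i - t - s)) * cf D (j - t) + fr s (cf D (j - t - s)) * cf C (i - t)) = 0"
proof -
  have "cf2 (\<lambda>x y. circ_fr s (A x) (B y) + \<alpha> * fr t (circ_fr s (C x) (D y))) i j
      = cf2 (\<lambda>x y. L2 (x * y)) i j" by (simp only: eq_ABCD)
  also have "\<dots> = 0" using assms by (simp add: cf2_diag)
  finally show ?thesis by (simp only: cf2_add cf2_scale cf2_fr_comp cf2_circ_fr)
qed

lemma cf_ABCD':
  assumes "\<not> [i = j] (mod int m)"
  shows "cf A i * cf D j + cf C i * cf B j = 0"
proof -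
  have "cf2 (\<lambda>x y. A x * D y + C x * B y) i j = cf2 (\<lambda>x y. L4 (x * y)) i j"
    by (simp only: eq_ABCD')
  then show ?thesis using assms by (simp add: cf2_add cf2_prod cf2_diag)
qed

section \<open>Supports of the coefficients and equality of the parameters\<close>

lemma two_nz: "(2 :: 'a) \<noteq> 0"
proof
  assume "(2 :: 'a) = 0"
  then have "p dvd 2"
    using of_nat_eq_0_iff_char_dvd[where ?'a = 'a, of 2] char_F by simp
  then show False
    using odd_p prime_p by (metis primes_dvd_imp_eq two_is_prime_nat even_numeral)
qed

lemma not_cong_sub_k: "\<not> [i - k = i] (mod int m)"
  using k_nz by (simp add: cong_iff_dvd_diff)

text \<open>The diagonal coefficient in \<open>cf_AC'\<close> is twice this product; the diagonal is
  admissible there because \<open>k\<close> is nonzero modulo \<open>m\<close>.\<close>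

lemma cf_A_C: "cf A i * cf C i = 0"
  using cf_AC'[OF not_cong_sub_k not_cong_sub_k, of i] two_nz
  by (simp add: mult.commute flip: mult_2)

lemma cf_B_D: "cf B i * cf D i = 0"
  using cf_BD'[OF not_cong_sub_k not_cong_sub_k, of i] two_nz
  by (simp add: mult.commute flip: mult_2)

text \<open>The hypotheses reflect that neither component of \<open>M\<close> and neither
  restriction to an axis is zero. Without a common index, \<open>cf_ABCD'\<close> extends to the
  diagonal, which leaves no coefficients for \<open>C\<close> and \<open>D\<close>, or none for
  \<open>A\<close> and \<open>B\<close>.\<close>

lemma ex_common_cf:
  assumes AB: "\<exists>i. cf A i \<noteq> 0 \<or> cf B i \<noteq> 0" and CD: "\<exists>i. cf C i \<noteq> 0 \<or> cf D i \<noteq> 0"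
    and AC: "\<exists>i. cf A i \<noteq> 0 \<or> cf C i \<noteq> 0" and BD: "\<exists>i. cf B i \<noteq> 0 \<or> cf D i \<noteq> 0"
  shows "\<exists>i. cf A i \<noteq> 0 \<and> cf D i \<noteq> 0 \<or> cf C i \<noteq> 0 \<and> cf B i \<noteq> 0"
proof (rule ccontr)
  assume no: "\<not> ?thesis"
  have eq: "cf A i * cf D j = - (cf C i * cf B j)" for i j
  proof (cases "[i = j] (mod int m)")
    case True
    then show ?thesis using no cf_cong[OF True] by (metis mult_eq_0_iff neg_equal_0_iff_equal)
  qed (use cf_ABCD' add_eq_0_iff2 in blast)
  show False
  proof (cases "\<exists>u. cf A u \<noteq> 0")
    case True
    then obtain u where u: "cf A u \<noteq> 0" by blast
    then have "cf C u = 0" using cf_A_C[of u] by simp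
    then have D: "cf D j = 0" for j using eq[of u j] u by simp
    then obtain v where "cf B v \<noteq> 0" using BD by auto
    then have "cf C i = 0" for i using eq[of i v] D by simp
    then show False using D CD by simp
  next
    case False
    then obtain u where "cf C u \<noteq> 0" using AC by auto
    then have "cf B j = 0" for j using eq[of u j] False by simp
    then show False using AB False by simp
  qed
qed

lemma parameters_eq:
  assumes A_nz: "cf A i \<noteq> 0" and D_nz: "cf D i \<noteq> 0"
  shows "[s = k] (mod int m) \<and> [t = r] (mod int m)"
proof -
  have "cf C i = 0" "cf B i = 0"
    using cf_A_C[of i] cf_B_D[of i] A_nz D_nz by auto
  \<comment> \<open>As \<open>C\<close> and \<open>B\<close> have no coefficient at
    \<open>i\<close>, the positions \<open>(i, j)\<close> and \<open>(j, i)\<close> make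
    \<open>A\<close> and \<open>D\<close> monomials.\<close>
  have D0: "cf D j = 0" if "\<not> int m dvd j - i" for j
    using cf_ABCD'[of i j] that A_nz \<open>cf C i = 0\<close> by (simp add: cong_iff_dvd_diff dvd_diff_commute)
  have A0: "cf A j = 0" if "\<not> int m dvd j - i" for j
    using cf_ABCD'[of j i] that D_nz \<open>cf B i = 0\<close> by (simp add: cong_iff_dvd_diff)
  have C_supp: "int m dvd j - i - k \<or> int m dvd j - i + k" if "cf C j \<noteq> 0" for j
  proof (rule ccontr)
    assume *: "\<not> ?thesis"
    then have "cf A i * cf C j + cf C i * cf A j = 0"
      by (intro cf_AC')
        (auto simp: cong_iff_dvd_diff algebra_simps dvd_diff_commute[of _ i "j + k"])
    then show False using A_nz that \<open>cf C i = 0\<close> by simp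
  qed
  have B_supp: "int m dvd j - i - k \<or> int m dvd j - i + k" if "cf B j \<noteq> 0" for j
  proof (rule ccontr)
    assume *: "\<not> ?thesis"
    then have "cf B i * cf D j + cf D i * cf B j = 0"
      by (intro cf_BD')
        (auto simp: cong_iff_dvd_diff algebra_simps dvd_diff_commute[of _ i "j + k"])
    then show False using D_nz that \<open>cf B i = 0\<close> by simp
  qed
  \<comment> \<open>Indices distinct modulo \<open>m\<close> cannot both be congruent to
    \<open>i\<close>, so the product of \<open>A\<close> and \<open>D\<close> vanishes.\<close>
  have BC: "int m dvd l - j" if "cf B j \<noteq> 0" "cf C l \<noteq> 0" for j l
  proof (rule ccontr)
    assume *: "\<not> ?thesis"
    then have "\<not> int m dvd l - i \<or> \<not> int m dvd j - i"
      using dvd_diff[of "int m" "l - i" "j - i"] by auto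
    then have "cf A l * cf D j = 0" using A0 D0 by auto
    moreover have "cf A l * cf D j + cf C l * cf B j = 0"
      using * by (intro cf_ABCD') (simp add: cong_iff_dvd_diff)
    ultimately show False using that by (metis add_0_left mult_eq_0_iff)
  qed
  have s2: "\<not> int m dvd 2 * s"
    using odd_torsion[OF odd_N N_s] s_nz by blast
  have N_diff: "int m dvd N * d" if "int m dvd d - k \<or> int m dvd d + k" for d
  proof -
    have "N * d = N * (d - k) + N * k" "N * d = N * (d + k) - N * k"
      by (simp_all add: algebra_simps)
    then show ?thesis using that N_k by (metis dvd_add dvd_diff dvd_mult)
  qed
  have d_nz: "\<not> int m dvd d" if "int m dvd d - k \<or> int m dvd d + k" for d
    using that k_nz by (auto simp: dvd_diff_right_iff dvd_add_right_iff)
  have s_cases: "\<not> int m dvd d - s \<or> \<not> int m dvd d + s" for d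
    using s2 dvd_diff[of "int m" "d + s" "d - s"] by auto

  \<comment> \<open>A nonzero \<open>cf B j\<close> confines \<open>C\<close> to index
    \<open>j\<close>. The aim is an off-diagonal position of \<open>cf_ABCD\<close> where only the
    product of \<open>cf A i\<close> and \<open>cf B j\<close>, up to Frobenius, survives.\<close>
  have B_zero: "cf B j = 0" for j
  proof (rule ccontr)
    assume Bj: "cf B j \<noteq> 0"
    define d where "d = j - i"
    have d: "int m dvd d - k \<or> int m dvd d + k" using B_supp[OF Bj] by (simp add: d_def)
    have N_ds: "int m dvd N * (d - s)"
      using N_diff[OF d] N_s by (simp add: right_diff_distrib)
    have C0: "cf C l = 0" if "\<not> int m dvd l - j" for l using BC[OF Bj] that by blast
    have CD1: "cf C (i - t) = 0 \<or> cf D (j - t) = 0"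
    proof (rule ccontr)
      assume "\<not> ?thesis"
      then have "int m dvd j - t - i" "int m dvd i - t - j" using C0 D0 by blast+
      then have "int m dvd (j - t - i) - (i - t - j)" by (rule dvd_diff)
      then have "int m dvd 2 * d" by (simp add: d_def algebra_simps)
      then show False using odd_torsion[OF odd_N N_diff[OF d]] d_nz[OF d] by blast
    qed
    show False
    \<comment> \<open>Position \<open>(i + s, j)\<close> is off the diagonal unless \<open>d\<close>
      is \<open>s\<close> modulo \<open>m\<close>; in that case \<open>(i, j + s)\<close> replaces
      it.\<close>
    proof (cases "int m dvd d - s")
      case False
      have "cf A (i + s) = 0" using A0 s_nz by simp
      moreover have "cf D (j - t - s) = 0 \<or> cf C (i + s - t) = 0"
      proof (rule ccontr)
        assume "\<not> ?thesis"
        then have "int m dvd j - t - s - i" "int m dvd i + s - t - j" using C0 D0 by blast+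
      then have "int m dvd (j - t - s - i) - (i + s - t - j)" by (rule dvd_diff)
        then have "int m dvd 2 * (d - s)" by (simp add: d_def algebra_simps)
        then show False using odd_torsion[OF odd_N N_ds] False by blast
      qed
      moreover have "\<not> [i + s = j] (mod int m)"
        using False by (simp add: cong_iff_dvd_diff d_def dvd_diff_commute[of _ "i + s"] algebra_simps)
      ultimately show False
        using cf_ABCD[of "i + s" j] CD1 A_nz Bj by (auto simp: algebra_simps)
    next
      case True
      then have ds: "\<not> int m dvd d + s" using s_cases by blast
      have N_ds': "int m dvd N * (d + s)"
        using N_diff[OF d] N_s by (simp add: distrib_left)
      have "cf A (i - s) = 0" using A0 s_nz by simp
      moreover have "cf C (i - t - s) = 0 \<or> cf D (j + s - t) = 0"
      proof (rule ccontr)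
        assume "\<not> ?thesis"
        then have "int m dvd j + s - t - i" "int m dvd i - t - s - j" using C0 D0 by blast+
      then have "int m dvd (j + s - t - i) - (i - t - s - j)" by (rule dvd_diff)
        then have "int m dvd 2 * (d + s)" by (simp add: d_def algebra_simps)
        then show False using odd_torsion[OF odd_N N_ds'] ds by blast
      qed
      moreover have "\<not> [i = j + s] (mod int m)"
        using ds by (simp add: cong_iff_dvd_diff d_def dvd_diff_commute[of _ i] algebra_simps)
      ultimately show False
        using cf_ABCD[of i "j + s"] CD1 A_nz Bj by (auto simp: algebra_simps)
    qed
  qed

  \<comment> \<open>With \<open>B\<close> gone, two positions each isolate \<open>cf C j\<close>
    against \<open>cf D i\<close>; one of them is off the diagonal since \<open>s\<close> and
    \<open>- s\<close> differ modulo \<open>m\<close>.\<close>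
  have C_zero: "cf C j = 0" for j
  proof (rule ccontr)
    assume Cj: "cf C j \<noteq> 0"
    have D_s: "cf D (i - s) = 0" "cf D (i + s) = 0" using D0 s_nz by auto
    consider "\<not> int m dvd j - i - s" | "\<not> int m dvd j - i + s" using s_cases by blast
    then show False
    proof cases
      case 1
      then have "\<not> [j + t = i + t + s] (mod int m)"
        by (simp add: cong_iff_dvd_diff algebra_simps)
      then show False
        using cf_ABCD[of "j + t" "i + t + s"] B_zero D_s Cj D_nz \<alpha>_nz by (simp add: algebra_simps)
    next
      case 2
      then have "\<not> [j + t + s = i + t] (mod int m)"
        by (simp add: cong_iff_dvd_diff algebra_simps)
      then show False
        using cf_ABCD[of "j + t + s" "i + t"] B_zero D_s Cj D_nz \<alpha>_nz by (simp add: algebra_simps)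
    qed
  qed

  \<comment> \<open>At position \<open>(j + s, j)\<close> of \<open>cf_AC\<close>, this removes the
    transposed product on the left, and \<open>sk'\<close> the transposed entry on the
    right.\<close>
  have AA: "cf A (j - s) = 0 \<or> cf A (j + s) = 0" for j
    using A0[of "j - s"] A0[of "j + s"] s_cases[of "j - i"] by (auto simp: algebra_simps)
  have sk': "\<not> [j - k = j + s] (mod int m)" for j
  proof -
    have "j - k - (j + s) = - (s + k)" by simp
    then show ?thesis using ks_nz by (simp only: cong_iff_dvd_diff dvd_minus_iff not_False_eq_True)
  qed
  have L1: "fr s (cf A j) * cf A j = of_bool [s = k] (mod int m) * cf L1 j" for j
  proof -
    have "[j + s - k = j] (mod int m) \<longleftrightarrow> [s = k] (mod int m)"
      by (simp add: cong_iff_dvd_diff)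
    then show ?thesis
      using cf_AC[of "j + s" j] C_zero AA[of j] sk' by auto
  qed
  have sk: "[s = k] (mod int m)"
  proof (rule ccontr)
    assume "\<not> ?thesis"
    then show False using L1[of i] A_nz by simp
  qed
  \<comment> \<open>Position \<open>(i + t + s, i + t)\<close> of \<open>cf_BD\<close> picks out
    \<open>cf D i\<close>. So \<open>L1\<close>, and hence \<open>A\<close>, has a coefficient at
    \<open>i + t - r\<close>, which must be index \<open>i\<close>.\<close>
  have "\<alpha> * fr t (fr s (cf D i) * cf D i)
      = fr (i + t - r) \<beta> * cf L1 (i + t - r)"
  proof -
    have "[i + t + s - k = i + t] (mod int m)"
      using sk by (simp add: cong_iff_dvd_diff)
    moreover have "cf D (i - s) = 0" using D0 s_nz by simp
    ultimately show ?thesis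
      using cf_BD[of "i + t + s" "i + t"] B_zero sk'[of "i + t"] by (simp add: algebra_simps)
  qed
  then have "cf L1 (i + t - r) \<noteq> 0" using \<alpha>_nz D_nz by auto
  then have "cf A (i + t - r) \<noteq> 0" using L1[of "i + t - r"] sk by auto
  then have "int m dvd i + t - r - i" using A0 by blast
  then show ?thesis using sk by (simp add: cong_iff_dvd_diff)
qed

end

section \<open>Parameter bounds and the theorem\<close>

lemma dvd_div_gcd_mult:
  fixes k m :: nat
  shows "m dvd (m div gcd m k) * k"
  by (metis div_mult_swap dvd_div_mult dvd_triv_left gcd_dvd1 gcd_dvd2)

text \<open>Otherwise \<open>m = 2 * k\<close>, and the quotient would be 2.\<close>

lemma add_lt_of_odd_quotient:
  fixes k m s :: nat
  assumes "odd (m div gcd m k)" "0 < k" "k \<le> m div 2" "s \<le> m div 2"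
  shows "s + k < m"
proof (rule ccontr)
  assume "\<not> ?thesis"
  then have "m = 2 * k" using assms(3,4) by linarith
  then show False using assms(1,2) by simp
qed

theorem theorem4:
  fixes \<alpha> :: "'a::{field, finite}"
    and p m k s r t :: nat
  assumes "prime p" and "odd p" and "m > 0"
    and "card (UNIV :: 'a set) = p ^ m"
    and "\<not> (\<exists>y. y ^ 2 = \<alpha>)"
    and "0 < k" and "k \<le> m div 2" and "0 < s" and "s \<le> m div 2"
    and "odd (m div gcd m k)" and "odd (m div gcd m s)"
    and "r \<le> m div 2" and "t \<le> m div 2"
    and "(k, (\<lambda>x::'a. x ^ (p ^ r))) \<noteq> (s, (\<lambda>x::'a. x ^ (p ^ t)))"
  shows "\<not> strongly_isotopic (pmult p \<alpha> k (\<lambda>x. x ^ (p ^ r))) (pmult p \<alpha> s (\<lambda>x. x ^ (p ^ t)))"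
proof
  interpret frobenius p m "TYPE('a)"
    by unfold_locales (use assms in auto)
  assume "strongly_isotopic (pmult p \<alpha> k (\<lambda>x. x ^ (p ^ r))) (pmult p \<alpha> s (\<lambda>x. x ^ (p ^ t)))"
  then obtain M L where M: "fp_linear2 M" "bij M" and L: "fp_linear2 L"
    and iso: "\<And>u v. pmult p \<alpha> s (\<lambda>x. x ^ (p ^ t)) (M u) (M v)
                = L (pmult p \<alpha> k (\<lambda>x. x ^ (p ^ r)) u v)"
    unfolding strongly_isotopic_def by blast
  have "\<alpha> \<noteq> 0" using assms(5) by (metis zero_power2)
  define A where "A x = fst (M (x, 0))" for x
  define B where "B x = fst (M (0, x))" for x
  define C where "C x = snd (M (x, 0))" for x
  define D where "D x = snd (M (0, x))" for x
  define L1 where "L1 x = fst (L (x, 0))" for x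
  define L2 where "L2 x = fst (L (0, x))" for x
  define L3 where "L3 x = snd (L (x, 0))" for x
  define L4 where "L4 x = snd (L (0, x))" for x
  have M_add: "M (a + c, b + d) = (fst (M (a, b)) + fst (M (c, d)), snd (M (a, b)) + snd (M (c, d)))"
    and M_scale: "M (of_nat n * a, of_nat n * b) = (of_nat n * fst (M (a, b)), of_nat n * snd (M (a, b)))"
    for a b c d n using M(1) unfolding fp_linear2_def by blast+
  have L_add: "L (a + c, b + d) = (fst (L (a, b)) + fst (L (c, d)), snd (L (a, b)) + snd (L (c, d)))"
    for a b c d using L unfolding fp_linear2_def by blast
  have M_x: "M (x, 0) = (A x, C x)" and M_y: "M (0, x) = (B x, D x)" for x
    by (simp_all add: A_def B_def C_def D_def)
  have L_x: "L (x, 0) = (L1 x, L3 x)" and L_y: "L (0, x) = (L2 x, L4 x)" for x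
    by (simp_all add: L1_def L2_def L3_def L4_def)
  have M_xy: "M (x, y) = (A x + B y, C x + D y)" for x y
    using M_add[of x 0 0 y] by (simp add: M_x M_y)
  have M_0: "M (0, 0) = (0, 0)" using M_scale[of 0 0 0] by simp
  have pm: "pmult p \<alpha> n (\<lambda>x. x ^ (p ^ q)) (a, b) (c, d)
      = (circ_fr (int n) a c + \<alpha> * fr (int q) (circ_fr (int n) b d), a * d + b * c)" for n q a b c d
    by (simp add: pmult_def circ_def circ_fr_def fr_int)
  have circ_fr_0: "circ_fr n 0 x = 0" "circ_fr n x 0 = 0" for n x by (simp_all add: circ_fr_def)
  \<comment> \<open>Each factor is odd and makes the corresponding \<open>k\<close> or
    \<open>s\<close> a multiple of \<open>m\<close>.\<close>
  define N where "N = int ((m div gcd m k) * (m div gcd m s))"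
  have sk: "s + k < m" using add_lt_of_odd_quotient assms by blast
  interpret isotopism p m "TYPE('a)" N "int k" "int s" "int r" "int t" \<alpha> \<alpha> A B C D L1 L2 L3 L4
  proof unfold_locales
    show "odd N" using assms by (simp add: N_def)
    show "int m dvd N * int k" "int m dvd N * int s"
      using dvd_mult[OF dvd_div_gcd_mult[of m k], of "m div gcd m s"]
        dvd_mult[OF dvd_div_gcd_mult[of m s], of "m div gcd m k"]
      unfolding N_def of_nat_mult[symmetric] of_nat_dvd_iff by (simp_all only: mult_ac)
    show "\<not> int m dvd int k" "\<not> int m dvd int s" "\<not> int m dvd int s + int k"
      using sk assms(6,8) unfolding of_nat_add[symmetric] of_nat_dvd_iff by (auto dest: dvd_imp_le)
    show "L1 (x + y) = L1 x + L1 y" "L3 (x + y) = L3 x + L3 y" for x y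
      using L_add[of x y 0 0] by (simp_all add: L_x)
    show "circ_fr (int s) (A x) (A y) + \<alpha> * fr (int t) (circ_fr (int s) (C x) (C y)) = L1 (circ_fr (int k) x y)"
      "A x * C y + C x * A y = L3 (circ_fr (int k) x y)" for x y
      using iso[of "(x, 0)" "(y, 0)"] by (simp_all add: pm M_x L_x circ_fr_0)
    show "circ_fr (int s) (B x) (B y) + \<alpha> * fr (int t) (circ_fr (int s) (D x) (D y))
        = L1 (\<alpha> * fr (int r) (circ_fr (int k) x y))"
      "B x * D y + D x * B y = L3 (\<alpha> * fr (int r) (circ_fr (int k) x y))" for x y
      using iso[of "(0, x)" "(0, y)"] by (simp_all add: pm M_y L_x circ_fr_0)
    show "circ_fr (int s) (A x) (B y) + \<alpha> * fr (int t) (circ_fr (int s) (C x) (D y)) = L2 (x * y)"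
      "A x * D y + C x * B y = L4 (x * y)" for x y
      using iso[of "(x, 0)" "(0, y)"] by (simp_all add: pm M_x M_y L_y circ_fr_0)
  qed (use assms \<open>\<alpha> \<noteq> 0\<close> in auto)
  have A_eq: "A x = 0" if "\<And>i. cf A i = 0" for x
    by (rule additive_eq_0[OF _ _ that]) (use M_add[of _ _ 0 0] M_scale[of _ _ 0] in \<open>auto simp: M_x\<close>)
  have C_eq: "C x = 0" if "\<And>i. cf C i = 0" for x
    by (rule additive_eq_0[OF _ _ that]) (use M_add[of _ _ 0 0] M_scale[of _ _ 0] in \<open>auto simp: M_x\<close>)
  have B_eq: "B x = 0" if "\<And>i. cf B i = 0" for x
    by (rule additive_eq_0[OF _ _ that]) (use M_add[of 0 0] M_scale[of _ 0] in \<open>auto simp: M_y\<close>)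
  have D_eq: "D x = 0" if "\<And>i. cf D i = 0" for x
    by (rule additive_eq_0[OF _ _ that]) (use M_add[of 0 0] M_scale[of _ 0] in \<open>auto simp: M_y\<close>)
  \<comment> \<open>Injectivity keeps \<open>M\<close> nonzero on both axes; surjectivity below
    keeps both components nonzero.\<close>
  have "M (1, 0) \<noteq> M (0, 0)" "M (0, 1) \<noteq> M (0, 0)"
    using bij_is_inj[OF \<open>bij M\<close>] by (simp_all add: inj_eq)
  then have "(A 1, C 1) \<noteq> (0, 0)" "(B 1, D 1) \<noteq> (0, 0)"
    unfolding M_0 by (simp_all only: M_x M_y not_False_eq_True)
  then have AC: "\<exists>i. cf A i \<noteq> 0 \<or> cf C i \<noteq> 0" and BD: "\<exists>i. cf B i \<noteq> 0 \<or> cf D i \<noteq> 0"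
    using A_eq B_eq C_eq D_eq by blast+
  obtain x y x' y' where "M (x, y) = (1, 0)" "M (x', y') = (0, 1)"
    using bij_is_surj[OF \<open>bij M\<close>] by (metis surj_pair surjD)
  then have "A x + B y \<noteq> 0" "C x' + D y' \<noteq> 0" by (auto simp: M_xy)
  then have AB: "\<exists>i. cf A i \<noteq> 0 \<or> cf B i \<noteq> 0" and CD: "\<exists>i. cf C i \<noteq> 0 \<or> cf D i \<noteq> 0"
    using A_eq B_eq C_eq D_eq by fastforce+
  have small: "n = n'" if "[int n = int n'] (mod int m)" "n < m" "n' < m" for n n'
    using that by (simp add: cong_int_iff cong_def)
  have "s = k \<and> t = r"
  proof -
    obtain i where "cf A i \<noteq> 0 \<and> cf D i \<noteq> 0 \<or> cf C i \<noteq> 0 \<and> cf B i \<noteq> 0"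
      using ex_common_cf[OF AB CD AC BD] by blast
    then show ?thesis
    proof
      assume "cf A i \<noteq> 0 \<and> cf D i \<noteq> 0"
      then have "[int s = int k] (mod int m)" "[int t = int r] (mod int m)"
        using parameters_eq by blast+
      then show ?thesis using sk assms by (auto intro!: small)
    next
      assume "cf C i \<noteq> 0 \<and> cf B i \<noteq> 0"
      then have *: "[int s = int k] (mod int m)" "[- int t = int r] (mod int m)"
        using isotopism.parameters_eq[OF swapped] by blast+
      then have "m dvd t + r"
        by (simp add: cong_iff_dvd_diff flip: of_nat_add)
          (metis add.commute dvd_minus_iff minus_diff_eq diff_minus_eq_add of_nat_add of_nat_dvd_iff)
      \<comment> \<open>Since \<open>r\<close> and \<open>t\<close> are at most
        \<open>m div 2\<close>, a sum of at least \<open>m\<close> forces both to be half of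
        \<open>m\<close>.\<close>
      then have "t + r = 0 \<or> m \<le> t + r" by (metis dvd_imp_le gr0I)
      then have "t = r" using assms(12,13) by linarith
      then show ?thesis using * sk by (auto intro!: small)
    qed
  qed
  then show False using assms(14) by simp
qed

end
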